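(* Let $G$ be a locally compact group acting vertex-transitively by automorphisms on a locally finite, infinite tree $X$, let $K\le G$ be the stabilizer of a vertex of $X$ (a maximal compact subgroup), so that $V(X)\simeq G/K$. Let $T$ be a finite abelian group, let $\alpha:G\times G\to T$ be a normalized 2-cocycle with $\alpha|_{K\times K}=1$, let $\widetilde G=G\times_\alpha T$, and fix a cross-section $\theta:G/K\to G$. Let $\widetilde X$ be the connected tree, and let $\sigma^{(\alpha)}:\widetilde G\times V(X)\to T$ be the cocycle, both defined in the context. Then, with the action \[ \tilde g(v_0) := (g(v))_0,\qquad \tilde g(v_\rho) := (g(v))_{\sigma^{(\alpha)}(\tilde g,v)\,\rho}\qquad (\tilde g=(g,t)\in\widetilde G,\ v\in V(X),\ \rho\in T), \] $\widetilde G$ acts on the connected tree $\widetilde X$ by automorphisms.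
   Context: A normalized 2-cocycle is a map $\alpha:G\times G\to T$ with $\alpha(g_1g_2,g_3)\alpha(g_1,g_2)=\alpha(g_1,g_2g_3)\alpha(g_2,g_3)$ and $\alpha(g,1)=\alpha(1,g)=1$. The group $\widetilde G=G\times_\alpha T$ is the set $G\times T$ with multiplication $(g_1,t_1)(g_2,t_2)=(g_1g_2,\alpha(g_1,g_2)t_1t_2)$. A cross-section is a map $\theta:G/K\to G$ with $\theta(x)K=x$. Put $\sigma(g,x)=\theta(gx)^{-1}g\theta(x)\in K$ and, for $\tilde g=(g,t)\in\widetilde G$ and $x\in G/K\simeq V(X)$, \[ \sigma^{(\alpha)}(\tilde g,x)=\alpha\bigl(g\theta(x),\sigma(g,x)^{-1}\bigr)\,\alpha\bigl(g,\theta(x)\bigr)\,t . \] The graph $\widetilde X$ has vertex set consisting of pairwise distinct vertices $v_0$ and $v_\rho$, for $v\in V(X)$ and $\rho\in T$ (the index $0$ is a symbol not in $T$; $v_0$ is identified with $v$). Its edges (all of unit length) are: $v_0$ is joined to $w_0$ whenever $v,w$ are adjacent in $X$; and $v_\rho$ is joined to $v_0$ for every $v\in V(X)$, $\rho\in T$. It is a connected, locally finite, infinite tree. *)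

theory Defs
  imports
    "HOL-Algebra.Group_Action"
    "HOL-Algebra.Left_Coset"
    "HOL-Analysis.Abstract_Topological_Spaces"
begin

section \<open>Simple undirected graphs and trees\<close>

record 'v ugraph =
  uverts :: "'v set"
  uedges :: "'v set set"

definition simple_graph :: "'v ugraph \<Rightarrow> bool" where
  "simple_graph X \<longleftrightarrow>
     (\<forall>e\<in>uedges X. \<exists>u\<in>uverts X. \<exists>v\<in>uverts X. u \<noteq> v \<and> e = {u, v})"

definition adjacent :: "'v ugraph \<Rightarrow> 'v \<Rightarrow> 'v \<Rightarrow> bool" where
  "adjacent X u v \<longleftrightarrow> {u, v} \<in> uedges X"

definition graph_walk :: "'v ugraph \<Rightarrow> 'v list \<Rightarrow> bool" where
  "graph_walk X p \<longleftrightarrow> p \<noteq> [] \<and> set p \<subseteq> uverts X \<and> successively (adjacent X) p"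

definition graph_connected :: "'v ugraph \<Rightarrow> bool" where
  "graph_connected X \<longleftrightarrow> uverts X \<noteq> {} \<and>
     (\<forall>u\<in>uverts X. \<forall>v\<in>uverts X. \<exists>p. graph_walk X p \<and> hd p = u \<and> last p = v)"

text \<open>The list of the vertices of a cycle does not repeat its initial vertex at the end.\<close>

definition graph_cycle :: "'v ugraph \<Rightarrow> 'v list \<Rightarrow> bool" where
  "graph_cycle X p \<longleftrightarrow>
     graph_walk X p \<and> distinct p \<and> length p \<ge> 3 \<and> adjacent X (last p) (hd p)"

definition tree_graph :: "'v ugraph \<Rightarrow> bool" where
  "tree_graph X \<longleftrightarrow> simple_graph X \<and> graph_connected X \<and> (\<nexists>p. graph_cycle X p)"

definition locally_finite_graph :: "'v ugraph \<Rightarrow> bool" where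
  "locally_finite_graph X \<longleftrightarrow> (\<forall>v\<in>uverts X. finite {w \<in> uverts X. adjacent X v w})"

definition graph_automorphism :: "'v ugraph \<Rightarrow> ('v \<Rightarrow> 'v) \<Rightarrow> bool" where
  "graph_automorphism X f \<longleftrightarrow> bij_betw f (uverts X) (uverts X) \<and>
     (\<forall>u\<in>uverts X. \<forall>v\<in>uverts X. adjacent X u v \<longleftrightarrow> adjacent X (f u) (f v))"

definition acts_by_automorphisms ::
    "('g, 'm) monoid_scheme \<Rightarrow> 'v ugraph \<Rightarrow> ('g \<Rightarrow> 'v \<Rightarrow> 'v) \<Rightarrow> bool" where
  "acts_by_automorphisms G X \<phi> \<longleftrightarrow>
     group_action G (uverts X) \<phi> \<and> (\<forall>g\<in>carrier G. graph_automorphism X (\<phi> g))"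


section \<open>Locally compact groups\<close>

definition topological_group_on :: "('g, 'm) monoid_scheme \<Rightarrow> 'g topology \<Rightarrow> bool" where
  "topological_group_on G \<tau> \<longleftrightarrow> group G \<and> topspace \<tau> = carrier G \<and>
     continuous_map (prod_topology \<tau> \<tau>) \<tau> (\<lambda>(x, y). x \<otimes>\<^bsub>G\<^esub> y) \<and>
     continuous_map \<tau> \<tau> (\<lambda>x. inv\<^bsub>G\<^esub> x)"

definition locally_compact_group :: "('g, 'm) monoid_scheme \<Rightarrow> 'g topology \<Rightarrow> bool" where
  "locally_compact_group G \<tau> \<longleftrightarrow>
     topological_group_on G \<tau> \<and> Hausdorff_space \<tau> \<and> locally_compact_space \<tau>"

definition maximal_compact_subgroup ::
    "('g, 'm) monoid_scheme \<Rightarrow> 'g topology \<Rightarrow> 'g set \<Rightarrow> bool" where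
  "maximal_compact_subgroup G \<tau> K \<longleftrightarrow> subgroup K G \<and> compactin \<tau> K \<and>
     (\<forall>L. subgroup L G \<and> compactin \<tau> L \<and> K \<subseteq> L \<longrightarrow> L = K)"


section \<open>Cocycles and the twisted product\<close>

definition normalized_2_cocycle ::
    "('g, 'm) monoid_scheme \<Rightarrow> ('t, 'n) monoid_scheme \<Rightarrow> ('g \<Rightarrow> 'g \<Rightarrow> 't) \<Rightarrow> bool" where
  "normalized_2_cocycle G T \<alpha> \<longleftrightarrow>
     (\<forall>g\<in>carrier G. \<forall>h\<in>carrier G. \<alpha> g h \<in> carrier T) \<and>
     (\<forall>g\<^sub>1\<in>carrier G. \<forall>g\<^sub>2\<in>carrier G. \<forall>g\<^sub>3\<in>carrier G.
        \<alpha> (g\<^sub>1 \<otimes>\<^bsub>G\<^esub> g\<^sub>2) g\<^sub>3 \<otimes>\<^bsub>T\<^esub> \<alpha> g\<^sub>1 g\<^sub>2 = \<alpha> g\<^sub>1 (g\<^sub>2 \<otimes>\<^bsub>G\<^esub> g\<^sub>3) \<otimes>\<^bsub>T\<^esub> \<alpha> g\<^sub>2 g\<^sub>3) \<and>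
     (\<forall>g\<in>carrier G. \<alpha> g \<one>\<^bsub>G\<^esub> = \<one>\<^bsub>T\<^esub> \<and> \<alpha> \<one>\<^bsub>G\<^esub> g = \<one>\<^bsub>T\<^esub>)"

definition twisted_product ::
    "('g, 'm) monoid_scheme \<Rightarrow> ('t, 'n) monoid_scheme \<Rightarrow> ('g \<Rightarrow> 'g \<Rightarrow> 't) \<Rightarrow> ('g \<times> 't) monoid" where
  "twisted_product G T \<alpha> =
     \<lparr>carrier = carrier G \<times> carrier T,
      mult = (\<lambda>(g\<^sub>1, t\<^sub>1) (g\<^sub>2, t\<^sub>2). (g\<^sub>1 \<otimes>\<^bsub>G\<^esub> g\<^sub>2, \<alpha> g\<^sub>1 g\<^sub>2 \<otimes>\<^bsub>T\<^esub> t\<^sub>1 \<otimes>\<^bsub>T\<^esub> t\<^sub>2)),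
      one = (\<one>\<^bsub>G\<^esub>, \<one>\<^bsub>T\<^esub>)\<rparr>"

definition cross_section ::
    "('g, 'm) monoid_scheme \<Rightarrow> 'g set \<Rightarrow> ('g set \<Rightarrow> 'g) \<Rightarrow> bool" where
  "cross_section G K \<theta> \<longleftrightarrow>
     (\<forall>x\<in>lcosets\<^bsub>G\<^esub> K. \<theta> x \<in> carrier G \<and> \<theta> x <#\<^bsub>G\<^esub> K = x)"

definition sigma :: "('g, 'm) monoid_scheme \<Rightarrow> ('g set \<Rightarrow> 'g) \<Rightarrow> 'g \<Rightarrow> 'g set \<Rightarrow> 'g" where
  "sigma G \<theta> g x = inv\<^bsub>G\<^esub> (\<theta> (g <#\<^bsub>G\<^esub> x)) \<otimes>\<^bsub>G\<^esub> g \<otimes>\<^bsub>G\<^esub> \<theta> x"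

definition sigma_twisted ::
    "('g, 'm) monoid_scheme \<Rightarrow> ('t, 'n) monoid_scheme \<Rightarrow> ('g \<Rightarrow> 'g \<Rightarrow> 't) \<Rightarrow> ('g set \<Rightarrow> 'g) \<Rightarrow>
     'g \<times> 't \<Rightarrow> 'g set \<Rightarrow> 't" where
  "sigma_twisted G T \<alpha> \<theta> = (\<lambda>(g, t) x.
     \<alpha> (g \<otimes>\<^bsub>G\<^esub> \<theta> x) (inv\<^bsub>G\<^esub> (sigma G \<theta> g x)) \<otimes>\<^bsub>T\<^esub> \<alpha> g (\<theta> x) \<otimes>\<^bsub>T\<^esub> t)"


section \<open>The extended tree and the action on it\<close>

text \<open>For a transitive action \<open>\<phi>\<close> and \<open>K = stabilizer G \<phi> b\<close>, the identification of
  \<open>G/K\<close> with the vertex set sends \<open>gK\<close> to \<open>\<phi> g b\<close>; this is its inverse.\<close>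

definition vertex_coset ::
    "('g, 'm) monoid_scheme \<Rightarrow> ('g \<Rightarrow> 'v \<Rightarrow> 'v) \<Rightarrow> 'v \<Rightarrow> 'v \<Rightarrow> 'g set" where
  "vertex_coset G \<phi> b v = {g \<in> carrier G. \<phi> g b = v}"

text \<open>\<open>(v, None)\<close> stands for the vertex \<open>v\<^sub>0\<close>, and \<open>(v, Some \<rho>)\<close> for \<open>v\<^sub>\<rho>\<close>.\<close>

definition extended_graph ::
    "'v ugraph \<Rightarrow> ('t, 'n) monoid_scheme \<Rightarrow> ('v \<times> 't option) ugraph" where
  "extended_graph X T =
     \<lparr>uverts = {(v, None) | v. v \<in> uverts X}
               \<union> {(v, Some \<rho>) | v \<rho>. v \<in> uverts X \<and> \<rho> \<in> carrier T},
      uedges = {{(v, None), (w, None)} | v w. v \<in> uverts X \<and> w \<in> uverts X \<and> adjacent X v w}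
               \<union> {{(v, Some \<rho>), (v, None)} | v \<rho>. v \<in> uverts X \<and> \<rho> \<in> carrier T}\<rparr>"

text \<open>The maps are restricted to the vertex set because \<^const>\<open>group_action\<close> requires
  extensional functions.\<close>

definition extended_action ::
    "('g, 'm) monoid_scheme \<Rightarrow> ('t, 'n) monoid_scheme \<Rightarrow> ('g \<Rightarrow> 'g \<Rightarrow> 't) \<Rightarrow> ('g set \<Rightarrow> 'g) \<Rightarrow>
     'v ugraph \<Rightarrow> ('g \<Rightarrow> 'v \<Rightarrow> 'v) \<Rightarrow> 'v \<Rightarrow> 'g \<times> 't \<Rightarrow> 'v \<times> 't option \<Rightarrow> 'v \<times> 't option" where
  "extended_action G T \<alpha> \<theta> X \<phi> b = (\<lambda>(g, t).
     restrict
       (\<lambda>(v, i). case i of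
           None \<Rightarrow> (\<phi> g v, None)
         | Some \<rho> \<Rightarrow>
             (\<phi> g v, Some (sigma_twisted G T \<alpha> \<theta> (g, t) (vertex_coset G \<phi> b v) \<otimes>\<^bsub>T\<^esub> \<rho>)))
       (uverts (extended_graph X T)))"

end

theory Submission
  imports Defs
begin

text \<open>The formula for \<open>\<sigma>\<^sup>(\<^sup>\<alpha>\<^sup>)\<close> says that, in the twisted product,
  \<open>(g, t) (\<theta> x, 1) (\<sigma>(g, x)\<inverse>, 1) = (\<theta> (g x), \<sigma>\<^sup>(\<^sup>\<alpha>\<^sup>)((g, t), x))\<close>.
  As \<open>\<alpha>\<close> is trivial on \<open>K\<close>, the elements \<open>(k, 1)\<close> with \<open>k \<in> K\<close> multiply as in \<open>K\<close>, and the
  elements \<open>(1, s)\<close> are central; hence the cocycle identity for \<open>\<sigma>\<^sup>(\<^sup>\<alpha>\<^sup>)\<close> follows from the one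
  for \<open>\<sigma>\<close> by associativity. The extended graph is a tree since it arises from \<open>X\<close> by attaching
  leaves, and a leaf does not lie on a cycle.\<close>

section \<open>Trees with leaves attached\<close>

lemma adjacent_sym: "adjacent X u v \<longleftrightarrow> adjacent X v u"
  by (simp add: adjacent_def insert_commute)

lemma adjacent_in_verts:
  assumes "simple_graph X" "adjacent X u v"
  shows "u \<in> uverts X" "v \<in> uverts X" "u \<noteq> v"
  using assms unfolding simple_graph_def adjacent_def by (force simp: doubleton_eq_iff)+

text \<open>The two neighbours are the cyclic predecessor and successor of \<open>x\<close>; they
  differ because the entries are distinct and there are at least three of them. This is what keeps
  vertices of degree one off every cycle.\<close>

lemma graph_cycle_two_neighbours:
  assumes "graph_cycle X p" "x \<in> set p"
  shows "\<exists>y z. y \<noteq> z \<and> adjacent X x y \<and> adjacent X x z"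
proof -
  have p: "successively (adjacent X) p" "distinct p" "length p \<ge> 3" "adjacent X (last p) (hd p)"
    using assms(1) by (auto simp: graph_cycle_def graph_walk_def)
  obtain q r where qr: "p = q @ x # r"
    using assms(2) by (auto simp: in_set_conv_decomp)
  have q: "adjacent X x (last q)" if "q \<noteq> []"
    using p(1) that by (subst adjacent_sym) (simp add: qr successively_append_iff)
  have r: "adjacent X x (hd r)" if "r \<noteq> []"
    using p(1) that by (simp add: qr successively_append_iff successively_Cons)
  consider "q = []" | "r = []" | "q \<noteq> []" "r \<noteq> []" by blast
  then show ?thesis
  proof cases
    \<comment> \<open>At the head of the list the predecessor is \<open>last r\<close>, reached
      through the closing edge. The length bound leaves at least two entries in \<open>r\<close>, so
      \<open>hd r\<close> and \<open>last r\<close> differ. The case \<open>r = []\<close> is the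
      mirror image.\<close>
    case 1
    obtain a b s where s: "r = a # b # s"
      using p(3) unfolding qr 1 by (cases r; cases "tl r") auto
    have "hd r \<noteq> last r" using p(2) unfolding qr 1 s by auto
    moreover have "adjacent X x (last r)" using p(4) unfolding qr 1 s by (simp add: adjacent_sym)
    ultimately show ?thesis using r s by blast
  next
    case 2
    obtain s a b where s: "q = s @ [a, b]"
      using p(3) unfolding qr 2 by (cases q rule: rev_cases; cases "butlast q" rule: rev_cases) auto
    have "hd q \<noteq> last q" using p(2) unfolding qr 2 s by (cases s) auto
    moreover have "adjacent X x (hd q)" using p(4) unfolding qr 2 s by (cases s) simp_all
    ultimately show ?thesis using q s by blast
  next
    case 3
    have "last q \<noteq> hd r" using p(2) last_in_set[OF 3(1)] hd_in_set[OF 3(2)] unfolding qr by auto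
    then show ?thesis using q r 3 by blast
  qed
qed

lemma extended_verts [simp]:
  "(v, i) \<in> uverts (extended_graph X T) \<longleftrightarrow> v \<in> uverts X \<and> (\<forall>\<rho>. i = Some \<rho> \<longrightarrow> \<rho> \<in> carrier T)"
  by (cases i) (auto simp: extended_graph_def)

text \<open>The first branch describes the copy of \<open>X\<close>. In the second branch the
  indices are not both \<open>None\<close>, so the disjunction says that exactly one end is a leaf,
  attached to the other end.\<close>

lemma adjacent_extended:
  "adjacent (extended_graph X T) (v, i) (w, j) \<longleftrightarrow>
     (v, i) \<in> uverts (extended_graph X T) \<and> (w, j) \<in> uverts (extended_graph X T) \<and>
     (if i = None \<and> j = None then adjacent X v w else v = w \<and> (i = None \<or> j = None))"
  by (cases i; cases j)
    (auto simp: adjacent_def extended_graph_def doubleton_eq_iff insert_commute)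

lemma tree_graph_extended:
  assumes "tree_graph X"
  shows "tree_graph (extended_graph X T)"
proof -
  let ?Y = "extended_graph X T"
  have simple: "simple_graph X" and conn: "graph_connected X" and acyclic: "\<nexists>p. graph_cycle X p"
    using assms by (auto simp: tree_graph_def)
  have "simple_graph ?Y"
    unfolding simple_graph_def
  proof
    fix e assume "e \<in> uedges ?Y"
    then consider v w where "adjacent X v w" "e = {(v, None), (w, None)}"
      | v \<rho> where "v \<in> uverts X" "\<rho> \<in> carrier T" "e = {(v, Some \<rho>), (v, None)}"
      by (auto simp: extended_graph_def)
    then show "\<exists>u\<in>uverts ?Y. \<exists>v\<in>uverts ?Y. u \<noteq> v \<and> e = {u, v}"
    proof cases
      case (1 v w)
      with adjacent_in_verts[OF simple 1(1)]
      have "(v, None) \<in> uverts ?Y" "(w, None) \<in> uverts ?Y" "(v, None) \<noteq> (w, None)" by auto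
      with 1(2) show ?thesis by blast
    next
      case (2 v \<rho>)
      then have "(v, Some \<rho>) \<in> uverts ?Y" "(v, None) \<in> uverts ?Y" "(v, Some \<rho>) \<noteq> (v, None)"
        by auto
      with 2(3) show ?thesis by blast
    qed
  qed
  moreover have "graph_connected ?Y"
    unfolding graph_connected_def
  proof (intro conjI ballI)
    obtain v where "v \<in> uverts X" using conn by (auto simp: graph_connected_def)
    then have "(v, None) \<in> uverts ?Y" by simp
    then show "uverts ?Y \<noteq> {}" by blast
  next
    fix x y assume xy: "x \<in> uverts ?Y" "y \<in> uverts ?Y"
    obtain v i w j where [simp]: "x = (v, i)" "y = (w, j)" by (meson surj_pair)
    have "v \<in> uverts X" "w \<in> uverts X" using xy by simp_all
    with conn obtain p where p: "graph_walk X p" "hd p = v" "last p = w"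
      unfolding graph_connected_def by blast
    then have ne [simp]: "p \<noteq> []" and sub: "set p \<subseteq> uverts X" and "successively (adjacent X) p"
      by (auto simp: graph_walk_def)
    then have "successively (adjacent ?Y) (map (\<lambda>v. (v, None)) p)"
      unfolding successively_map by (auto elim!: successively_mono simp: adjacent_extended)
    \<comment> \<open>The walk in \<open>X\<close> is lifted to the copy of \<open>X\<close>. A leaf
      at either end is prepended or appended; it is adjacent to the lift of its own base vertex,
      which is where the lifted walk starts or stops.\<close>
    moreover define q where "q = (if i = None then [] else [(v, i)]) @ map (\<lambda>v. (v, None)) p
                                   @ (if j = None then [] else [(w, j)])"
    ultimately have "graph_walk ?Y q"
      using xy sub p
      by (auto simp: q_def graph_walk_def successively_append_iff successively_Cons hd_map last_map
          adjacent_extended)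
    moreover have "hd q = x" "last q = y"
      using p by (auto simp: q_def hd_append last_append hd_map last_map)
    ultimately show "\<exists>p. graph_walk ?Y p \<and> hd p = x \<and> last p = y" by blast
  qed
  moreover have False if c: "graph_cycle ?Y p" for p
  proof -
    \<comment> \<open>A leaf has its base vertex as only neighbour, whereas a vertex of a cycle has
      two.\<close>
    have "snd x = None" if "x \<in> set p" for x
    proof (rule ccontr)
      assume "snd x \<noteq> None"
      obtain y z where "y \<noteq> z" "adjacent ?Y x y" "adjacent ?Y x z"
        using graph_cycle_two_neighbours[OF c \<open>x \<in> set p\<close>] by blast
      with \<open>snd x \<noteq> None\<close> show False
        by (cases x; cases y; cases z) (auto simp: adjacent_extended split: if_splits)
    qed
    then have p: "p = map (\<lambda>v. (v, None)) (map fst p)"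
      by (simp add: map_idI prod_eq_iff)
    \<comment> \<open>Without leaves the cycle lies in the copy of \<open>X\<close>, so its
      projection is a cycle of \<open>X\<close>.\<close>
    define q where "q = map fst p"
    have pq: "p = map (\<lambda>v. (v, None)) q" using p q_def by simp
    from c have "graph_cycle X q"
      by (auto simp: pq graph_cycle_def graph_walk_def distinct_map successively_map hd_map
          last_map adjacent_extended elim!: successively_mono)
    with acyclic show False by blast
  qed
  ultimately show ?thesis by (auto simp: tree_graph_def)
qed


section \<open>Group actions given by composition laws\<close>

text \<open>Bijectivity comes for free from the two laws, since \<open>inv g\<close> acts as the
  inverse map. Extensionality is required because the product in \<open>BijGroup E\<close> is
  composition restricted to \<open>E\<close>.\<close>

lemma group_actionI:
  assumes "group G"
    and ext: "\<And>g. g \<in> carrier G \<Longrightarrow> \<phi> g \<in> extensional E"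
    and closed: "\<And>g x. g \<in> carrier G \<Longrightarrow> x \<in> E \<Longrightarrow> \<phi> g x \<in> E"
    and one: "\<And>x. x \<in> E \<Longrightarrow> \<phi> \<one>\<^bsub>G\<^esub> x = x"
    and mult: "\<And>g h x. g \<in> carrier G \<Longrightarrow> h \<in> carrier G \<Longrightarrow> x \<in> E \<Longrightarrow>
                 \<phi> (g \<otimes>\<^bsub>G\<^esub> h) x = \<phi> g (\<phi> h x)"
  shows "group_action G E \<phi>"
proof -
  interpret group G by fact
  have bij: "\<phi> g \<in> Bij E" if g: "g \<in> carrier G" for g
  proof -
    have "bij_betw (\<phi> g) E E"
    proof (rule bij_betw_byWitness[where f' = "\<phi> (inv\<^bsub>G\<^esub> g)"])
      show "\<forall>x\<in>E. \<phi> (inv\<^bsub>G\<^esub> g) (\<phi> g x) = x" "\<forall>x\<in>E. \<phi> g (\<phi> (inv\<^bsub>G\<^esub> g) x) = x"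
        using g by (simp_all flip: mult add: one)
    qed (use g closed in auto)
    with g ext show ?thesis by (simp add: Bij_def)
  qed
  have "\<phi> \<in> hom G (BijGroup E)"
  proof (rule homI)
    fix g h assume gh: "g \<in> carrier G" "h \<in> carrier G"
    \<comment> \<open>Both sides are extensional on \<open>E\<close>, so agreement at the points of
      \<open>E\<close> suffices.\<close>
    have "\<phi> (g \<otimes>\<^bsub>G\<^esub> h) = compose E (\<phi> g) (\<phi> h)"
      using gh by (intro extensionalityI[where A = E] ext) (auto simp: mult compose_def)
    then show "\<phi> (g \<otimes>\<^bsub>G\<^esub> h) = \<phi> g \<otimes>\<^bsub>BijGroup E\<^esub> \<phi> h"
      using gh by (simp add: BijGroup_def bij)
  qed (simp add: BijGroup_def bij)
  then show ?thesis
    by (auto simp: group_action_def group_hom_def group_hom_axioms_def group_BijGroup \<open>group G\<close>)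
qed


section \<open>The twisted product and its cocycle\<close>

locale cocycle_twist = G: group G + T: comm_group T
  for G :: "('g, 'm) monoid_scheme" (structure) and T :: "('t, 'n) monoid_scheme" +
  fixes \<alpha> :: "'g \<Rightarrow> 'g \<Rightarrow> 't"
  assumes cocycle: "normalized_2_cocycle G T \<alpha>"
begin

abbreviation P where "P \<equiv> twisted_product G T \<alpha>"

lemma \<alpha>_closed [simp]: "g \<in> carrier G \<Longrightarrow> h \<in> carrier G \<Longrightarrow> \<alpha> g h \<in> carrier T"
  and \<alpha>_one [simp]: "g \<in> carrier G \<Longrightarrow> \<alpha> g \<one> = \<one>\<^bsub>T\<^esub>" "g \<in> carrier G \<Longrightarrow> \<alpha> \<one> g = \<one>\<^bsub>T\<^esub>"
  using cocycle by (auto simp: normalized_2_cocycle_def)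

lemma \<alpha>_assoc:
  assumes "g \<in> carrier G" "h \<in> carrier G" "k \<in> carrier G"
  shows "\<alpha> (g \<otimes> h) k \<otimes>\<^bsub>T\<^esub> \<alpha> g h = \<alpha> g (h \<otimes> k) \<otimes>\<^bsub>T\<^esub> \<alpha> h k"
  using cocycle assms by (auto simp: normalized_2_cocycle_def)

lemma P_carrier [simp]: "(g, t) \<in> carrier P \<longleftrightarrow> g \<in> carrier G \<and> t \<in> carrier T"
  and P_mult [simp]: "(g, t) \<otimes>\<^bsub>P\<^esub> (h, s) = (g \<otimes> h, \<alpha> g h \<otimes>\<^bsub>T\<^esub> t \<otimes>\<^bsub>T\<^esub> s)"
  and P_one: "\<one>\<^bsub>P\<^esub> = (\<one>, \<one>\<^bsub>T\<^esub>)"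
  by (simp_all add: twisted_product_def)

text \<open>Associativity is the 2-cocycle identity, the remaining factors being rearranged in the
  abelian group \<open>T\<close>. Normalization makes the pair of units neutral.\<close>

lemma group_P: "group P"
proof (rule groupI)
  fix u v w assume "u \<in> carrier P" "v \<in> carrier P" "w \<in> carrier P"
  moreover obtain g r h s k t where "u = (g, r)" "v = (h, s)" "w = (k, t)"
    by (metis surj_pair)
  moreover
  have "\<alpha> (g \<otimes> h) k \<otimes>\<^bsub>T\<^esub> (\<alpha> g h \<otimes>\<^bsub>T\<^esub> r \<otimes>\<^bsub>T\<^esub> s) \<otimes>\<^bsub>T\<^esub> t
      = \<alpha> g (h \<otimes> k) \<otimes>\<^bsub>T\<^esub> r \<otimes>\<^bsub>T\<^esub> (\<alpha> h k \<otimes>\<^bsub>T\<^esub> s \<otimes>\<^bsub>T\<^esub> t)"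
    if [simp]: "g \<in> carrier G" "h \<in> carrier G" "k \<in> carrier G"
      "r \<in> carrier T" "s \<in> carrier T" "t \<in> carrier T"
  proof -
    have "\<alpha> (g \<otimes> h) k \<otimes>\<^bsub>T\<^esub> (\<alpha> g h \<otimes>\<^bsub>T\<^esub> r \<otimes>\<^bsub>T\<^esub> s) \<otimes>\<^bsub>T\<^esub> t
        = (\<alpha> (g \<otimes> h) k \<otimes>\<^bsub>T\<^esub> \<alpha> g h) \<otimes>\<^bsub>T\<^esub> (r \<otimes>\<^bsub>T\<^esub> s \<otimes>\<^bsub>T\<^esub> t)"
      by (simp add: T.m_assoc)
    also have "\<dots> = \<alpha> g (h \<otimes> k) \<otimes>\<^bsub>T\<^esub> r \<otimes>\<^bsub>T\<^esub> (\<alpha> h k \<otimes>\<^bsub>T\<^esub> s \<otimes>\<^bsub>T\<^esub> t)"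
      unfolding \<alpha>_assoc[OF that(1-3)] by (simp add: T.m_ac)
    finally show ?thesis .
  qed
  ultimately show "u \<otimes>\<^bsub>P\<^esub> v \<otimes>\<^bsub>P\<^esub> w = u \<otimes>\<^bsub>P\<^esub> (v \<otimes>\<^bsub>P\<^esub> w)"
    by (simp add: G.m_assoc)
next
  fix u assume "u \<in> carrier P"
  moreover obtain g t where "u = (g, t)" by fastforce
  ultimately show "\<exists>v\<in>carrier P. v \<otimes>\<^bsub>P\<^esub> u = \<one>\<^bsub>P\<^esub>"
    \<comment> \<open>The second component is chosen to cancel both \<open>t\<close> and the value
      of \<alpha> that the multiplication introduces.\<close>
    by (intro bexI[of _ "(inv g, inv\<^bsub>T\<^esub> (\<alpha> (inv g) g \<otimes>\<^bsub>T\<^esub> t))"])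
      (simp_all add: P_one T.inv_mult_group T.m_ac T.r_inv)
qed (auto simp: P_one)

end

section \<open>The cross-section and its K-valued cocycle\<close>

locale twisted_cross_section = cocycle_twist G T \<alpha>
  for G :: "('g, 'm) monoid_scheme" (structure) and T :: "('t, 'n) monoid_scheme" and \<alpha> +
  fixes K :: "'g set" and \<theta> :: "'g set \<Rightarrow> 'g"
  assumes subgroup_K: "subgroup K G"
    and \<alpha>_K: "\<And>k k'. k \<in> K \<Longrightarrow> k' \<in> K \<Longrightarrow> \<alpha> k k' = \<one>\<^bsub>T\<^esub>"
    and cross: "cross_section G K \<theta>"
begin

lemma K_closed [simp]: "k \<in> K \<Longrightarrow> k \<in> carrier G"
  by (rule subgroup.mem_carrier[OF subgroup_K])

lemma K_inv: "k \<in> K \<Longrightarrow> inv k \<in> K"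
  by (rule subgroup.m_inv_closed[OF subgroup_K])

lemma lcoset_closed:
  assumes "x \<in> lcosets K"
  shows "x \<subseteq> carrier G"
  using assms G.lcosets_subset_PowG[OF subgroup_K] by blast

lemma \<theta>_closed [simp]: "x \<in> lcosets K \<Longrightarrow> \<theta> x \<in> carrier G"
  and \<theta>_coset: "x \<in> lcosets K \<Longrightarrow> \<theta> x <# K = x"
  using cross by (auto simp: cross_section_def)

lemma translate_lcoset [simp]:
  assumes "g \<in> carrier G" "x \<in> lcosets K"
  shows "g <# x \<in> lcosets K"
proof -
  \<comment> \<open>Writing \<open>x\<close> as \<open>\<theta> x <# K\<close> exhibits a
    representative of the translate.\<close>
  have "(g \<otimes> \<theta> x) <# K = g <# x"
    using assms by (simp add: \<theta>_coset flip: G.lcos_m_assoc[OF subgroup.subset[OF subgroup_K]])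
  then show ?thesis
    using assms unfolding LCOSETS_def
    by (metis (no_types, lifting) G.m_closed LCOSETS_def UN_iff \<theta>_closed singletonI)
qed

lemma sigma_closed [simp]:
  assumes "g \<in> carrier G" "x \<in> lcosets K"
  shows "sigma G \<theta> g x \<in> carrier G"
  using assms by (simp add: sigma_def)

lemma sigma_eq:
  assumes "g \<in> carrier G" "x \<in> lcosets K"
  shows "\<theta> (g <# x) \<otimes> sigma G \<theta> g x = g \<otimes> \<theta> x"
  using assms by (simp add: sigma_def G.m_assoc[symmetric])

text \<open>Both \<open>g \<otimes> \<theta> x\<close> and \<open>\<theta> (g <# x)\<close>
  represent the coset \<open>g <# x\<close>, so they differ on the right by an element of
  \<open>K\<close>; by cancellation in \<open>sigma_eq\<close> that element is sigma.\<close>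

lemma sigma_in_K:
  assumes "g \<in> carrier G" "x \<in> lcosets K"
  shows "sigma G \<theta> g x \<in> K"
proof -
  have "\<theta> x \<in> x"
    using G.lcos_self[OF \<theta>_closed[OF assms(2)] subgroup_K] assms(2) by (simp add: \<theta>_coset)
  then have "g \<otimes> \<theta> x \<in> \<theta> (g <# x) <# K"
    using assms unfolding \<theta>_coset[OF translate_lcoset[OF assms]] by (auto simp: l_coset_def)
  then obtain k where "k \<in> K" "g \<otimes> \<theta> x = \<theta> (g <# x) \<otimes> k"
    by (auto simp: l_coset_def)
  with assms have "sigma G \<theta> g x = k"
    by (metis G.Units_eq G.Units_l_cancel K_closed \<theta>_closed sigma_closed sigma_eq translate_lcoset)
  with \<open>k \<in> K\<close> show ?thesis by simp
qed

lemma translate_translate: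
  assumes "g \<in> carrier G" "h \<in> carrier G" "x \<in> lcosets K"
  shows "(g \<otimes> h) <# x = g <# (h <# x)"
  using assms by (simp add: G.lcos_m_assoc lcoset_closed)

text \<open>Multiplied on the left by the representative of \<open>g <# (h <# x)\<close>, both sides
  become \<open>g \<otimes> h \<otimes> \<theta> x\<close>, by one use of \<open>sigma_eq\<close> on
  one side and two on the other.\<close>

lemma sigma_mult:
  assumes [simp]: "g \<in> carrier G" "h \<in> carrier G" "x \<in> lcosets K"
  shows "sigma G \<theta> (g \<otimes> h) x = sigma G \<theta> g (h <# x) \<otimes> sigma G \<theta> h x"
proof -
  have "\<theta> (g <# (h <# x)) \<otimes> sigma G \<theta> (g \<otimes> h) x = g \<otimes> (h \<otimes> \<theta> x)"
    by (simp add: sigma_eq G.m_assoc flip: translate_translate)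
  also have "\<dots> = \<theta> (g <# (h <# x)) \<otimes> (sigma G \<theta> g (h <# x) \<otimes> sigma G \<theta> h x)"
    by (simp flip: sigma_eq G.m_assoc)
  finally show ?thesis by (subst (asm) G.Units_l_cancel) auto
qed

section \<open>The T-valued twisted cocycle\<close>

lemma sigma_twisted_closed [simp]:
  assumes "u \<in> carrier P" "x \<in> lcosets K"
  shows "sigma_twisted G T \<alpha> \<theta> u x \<in> carrier T"
  using assms by (cases u) (simp add: sigma_twisted_def)

text \<open>The first component is \<open>sigma_eq\<close> with sigma cancelled against its inverse;
  the second collects the values of \<alpha> produced by the two multiplications, which are those in
  the definition.\<close>

lemma sigma_twisted_eq:
  assumes "(g, t) \<in> carrier P" "x \<in> lcosets K"
  shows "(g, t) \<otimes>\<^bsub>P\<^esub> (\<theta> x, \<one>\<^bsub>T\<^esub>) \<otimes>\<^bsub>P\<^esub> (inv (sigma G \<theta> g x), \<one>\<^bsub>T\<^esub>)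
       = (\<theta> (g <# x), sigma_twisted G T \<alpha> \<theta> (g, t) x)"
  using assms by (simp add: sigma_twisted_def T.m_assoc flip: sigma_eq)
    (simp add: G.m_assoc)

lemma sigma_twisted_mult:
  assumes u: "(g, t) \<in> carrier P" and v: "(h, s) \<in> carrier P" and x: "x \<in> lcosets K"
  shows "sigma_twisted G T \<alpha> \<theta> ((g, t) \<otimes>\<^bsub>P\<^esub> (h, s)) x
       = sigma_twisted G T \<alpha> \<theta> (g, t) (h <# x) \<otimes>\<^bsub>T\<^esub> sigma_twisted G T \<alpha> \<theta> (h, s) x"
proof -
  interpret P: group P by (rule group_P)
  define k where "k = inv (sigma G \<theta> h x)"
  define l where "l = inv (sigma G \<theta> g (h <# x))"
  define r where "r = sigma_twisted G T \<alpha> \<theta> (h, s) x"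
  define q where "q = sigma_twisted G T \<alpha> \<theta> (g, t) (h <# x)"
  have g: "g \<in> carrier G" and h: "h \<in> carrier G" using u v by simp_all
  then have kl: "k \<in> K" "l \<in> K" using x unfolding k_def l_def by (intro K_inv sigma_in_K; simp)+
  have rq [simp]: "r \<in> carrier T" "q \<in> carrier T"
    unfolding r_def q_def using u v g h x by (auto simp del: P_carrier)
  \<comment> \<open>Inversion reverses the factors in \<open>sigma_mult\<close>. The factor
    \<open>k\<close> belonging to \<open>h\<close> thus comes first, where it can be absorbed by
    \<open>(h, s)\<close> and \<open>\<theta> x\<close>.\<close>
  have "k \<otimes> l = inv (sigma G \<theta> (g \<otimes> h) x)"
    using g h x by (simp add: k_def l_def sigma_mult G.inv_mult_group)
  then have "(\<theta> ((g \<otimes> h) <# x), sigma_twisted G T \<alpha> \<theta> ((g, t) \<otimes>\<^bsub>P\<^esub> (h, s)) x)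
     = (g, t) \<otimes>\<^bsub>P\<^esub> (h, s) \<otimes>\<^bsub>P\<^esub> (\<theta> x, \<one>\<^bsub>T\<^esub>) \<otimes>\<^bsub>P\<^esub> (k \<otimes> l, \<one>\<^bsub>T\<^esub>)"
    using sigma_twisted_eq[of "g \<otimes> h" "\<alpha> g h \<otimes>\<^bsub>T\<^esub> t \<otimes>\<^bsub>T\<^esub> s" x] u v x by simp
  \<comment> \<open>Triviality of \<alpha> on \<open>K\<close> enters here: \<open>K\<close> embeds
    in \<open>P\<close> as a set of pairs multiplying without a twist.\<close>
  also have "(k \<otimes> l, \<one>\<^bsub>T\<^esub>) = (k, \<one>\<^bsub>T\<^esub>) \<otimes>\<^bsub>P\<^esub> (l, \<one>\<^bsub>T\<^esub>)"
    using kl by (simp add: \<alpha>_K)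
  also have "(g, t) \<otimes>\<^bsub>P\<^esub> (h, s) \<otimes>\<^bsub>P\<^esub> (\<theta> x, \<one>\<^bsub>T\<^esub>) \<otimes>\<^bsub>P\<^esub> ((k, \<one>\<^bsub>T\<^esub>) \<otimes>\<^bsub>P\<^esub> (l, \<one>\<^bsub>T\<^esub>))
     = (g, t) \<otimes>\<^bsub>P\<^esub> ((h, s) \<otimes>\<^bsub>P\<^esub> (\<theta> x, \<one>\<^bsub>T\<^esub>) \<otimes>\<^bsub>P\<^esub> (k, \<one>\<^bsub>T\<^esub>)) \<otimes>\<^bsub>P\<^esub> (l, \<one>\<^bsub>T\<^esub>)"
    using u v x kl by (simp add: P.m_assoc del: P_mult)
  \<comment> \<open>Splitting off \<open>r\<close> leaves the pair of
    \<open>\<theta> (h <# x)\<close> and the unit, the form needed to apply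
    \<open>sigma_twisted_eq\<close> again, now to \<open>(g, t)\<close>.\<close>
  also have "(h, s) \<otimes>\<^bsub>P\<^esub> (\<theta> x, \<one>\<^bsub>T\<^esub>) \<otimes>\<^bsub>P\<^esub> (k, \<one>\<^bsub>T\<^esub>) = (\<theta> (h <# x), \<one>\<^bsub>T\<^esub>) \<otimes>\<^bsub>P\<^esub> (\<one>, r)"
    using sigma_twisted_eq[OF v x] h x by (simp add: k_def r_def[symmetric])
  also have "(g, t) \<otimes>\<^bsub>P\<^esub> ((\<theta> (h <# x), \<one>\<^bsub>T\<^esub>) \<otimes>\<^bsub>P\<^esub> (\<one>, r)) \<otimes>\<^bsub>P\<^esub> (l, \<one>\<^bsub>T\<^esub>)
     = (g, t) \<otimes>\<^bsub>P\<^esub> (\<theta> (h <# x), \<one>\<^bsub>T\<^esub>) \<otimes>\<^bsub>P\<^esub> ((\<one>, r) \<otimes>\<^bsub>P\<^esub> (l, \<one>\<^bsub>T\<^esub>))"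
    using u h x kl by (simp add: P.m_assoc del: P_mult)
  \<comment> \<open>By normalization no value of \<alpha> appears in either order, so
    \<open>r\<close> moves to the far right.\<close>
  also have "(\<one>, r) \<otimes>\<^bsub>P\<^esub> (l, \<one>\<^bsub>T\<^esub>) = (l, \<one>\<^bsub>T\<^esub>) \<otimes>\<^bsub>P\<^esub> (\<one>, r)"
    using kl by simp
  also have "(g, t) \<otimes>\<^bsub>P\<^esub> (\<theta> (h <# x), \<one>\<^bsub>T\<^esub>) \<otimes>\<^bsub>P\<^esub> ((l, \<one>\<^bsub>T\<^esub>) \<otimes>\<^bsub>P\<^esub> (\<one>, r))
     = (g, t) \<otimes>\<^bsub>P\<^esub> (\<theta> (h <# x), \<one>\<^bsub>T\<^esub>) \<otimes>\<^bsub>P\<^esub> (l, \<one>\<^bsub>T\<^esub>) \<otimes>\<^bsub>P\<^esub> (\<one>, r)"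
    using u h x kl by (simp add: P.m_assoc del: P_mult)
  also have "\<dots> = (\<theta> (g <# (h <# x)), q \<otimes>\<^bsub>T\<^esub> r)"
    using sigma_twisted_eq[OF u, of "h <# x"] g h x by (simp add: l_def q_def[symmetric])
  finally show ?thesis by (simp add: q_def r_def)
qed

text \<open>Since sigma is trivial at the unit of \<open>G\<close>, each value of \<alpha> in the
  formula has the unit as an argument.\<close>

lemma sigma_twisted_one:
  assumes x: "x \<in> lcosets K"
  shows "sigma_twisted G T \<alpha> \<theta> \<one>\<^bsub>P\<^esub> x = \<one>\<^bsub>T\<^esub>"
  using x by (simp add: P_one sigma_twisted_def sigma_def G.lcos_mult_one lcoset_closed)

end

section \<open>Vertices as cosets and the action on the extended graph\<close>

locale transitive_extension =
  twisted_cross_section G T \<alpha> K \<theta> + transitive_action G V \<phi>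
  for G :: "('g, 'm) monoid_scheme" (structure) and T :: "('t, 'n) monoid_scheme" and \<alpha> K \<theta>
    and V :: "'v set" and \<phi> +
  fixes b :: 'v
  assumes base: "b \<in> V" and K_eq: "K = stabilizer G \<phi> b"
begin

lemma mem_K: "k \<in> K \<longleftrightarrow> k \<in> carrier G \<and> \<phi> k b = b"
  unfolding K_eq stabilizer_def by blast

text \<open>This is the orbit-stabilizer correspondence: \<open>g\<close> and \<open>h\<close> move
  \<open>b\<close> to the same vertex exactly when \<open>inv g \<otimes> h\<close> fixes
  \<open>b\<close>.\<close>

lemma vertex_coset_translate:
  assumes g: "g \<in> carrier G"
  shows "vertex_coset G \<phi> b (\<phi> g b) = g <# K"
proof
  show "vertex_coset G \<phi> b (\<phi> g b) \<subseteq> g <# K"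
  proof
    fix h assume "h \<in> vertex_coset G \<phi> b (\<phi> g b)"
    then have h: "h \<in> carrier G" "\<phi> h b = \<phi> g b" by (auto simp: vertex_coset_def)
    have "\<phi> (inv g \<otimes> h) b = b"
      using orbit_sym_aux[OF g base refl] composition_rule[OF base G.inv_closed[OF g] h(1)] h
      by simp
    then have "inv g \<otimes> h \<in> K"
      using g h unfolding mem_K by simp
    moreover have "h = g \<otimes> (inv g \<otimes> h)" using g h by (simp flip: G.m_assoc)
    ultimately show "h \<in> g <# K" by (auto simp: l_coset_def)
  qed
  show "g <# K \<subseteq> vertex_coset G \<phi> b (\<phi> g b)"
    using g base by (auto simp: vertex_coset_def l_coset_def composition_rule dest!: mem_K[THEN iffD1])
qed

lemma vertex_coset_in_lcosets [simp]:
  assumes "v \<in> V"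
  shows "vertex_coset G \<phi> b v \<in> lcosets K"
  using unique_orbit[OF base assms] by (auto simp: vertex_coset_translate LCOSETS_def)

text \<open>By transitivity \<open>v\<close> is \<open>\<phi> h b\<close> for some \<open>h\<close>,
  and both sides are then the coset of \<open>g \<otimes> h\<close>. The cocycle identity, stated
  for cosets, thereby applies to vertices.\<close>

lemma vertex_coset_equivariant:
  assumes g: "g \<in> carrier G" and "v \<in> V"
  shows "vertex_coset G \<phi> b (\<phi> g v) = g <# vertex_coset G \<phi> b v"
proof -
  obtain h where h: "h \<in> carrier G" "v = \<phi> h b" using unique_orbit[OF base assms(2)] by blast
  then have "vertex_coset G \<phi> b (\<phi> g v) = (g \<otimes> h) <# K"
    using g base by (simp flip: composition_rule vertex_coset_translate)
  with g h show ?thesis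
    by (simp add: vertex_coset_translate G.lcos_m_assoc[OF subgroup.subset[OF subgroup_K]])
qed

lemma extended_action_simps:
  assumes "v \<in> uverts X"
  shows "extended_action G T \<alpha> \<theta> X \<phi> b u (v, None) = (\<phi> (fst u) v, None)"
    and "\<rho> \<in> carrier T \<Longrightarrow> extended_action G T \<alpha> \<theta> X \<phi> b u (v, Some \<rho>)
      = (\<phi> (fst u) v, Some (sigma_twisted G T \<alpha> \<theta> u (vertex_coset G \<phi> b v) \<otimes>\<^bsub>T\<^esub> \<rho>))"
  using assms by (cases u; simp add: extended_action_def)+

text \<open>Over \<open>v\<^sub>0\<close> the laws are those of \<phi>. On leaves they are the
  cocycle identity and the value at the unit of the twisted cocycle.\<close>

lemma group_action_extended:
  assumes X: "V = uverts X"
  shows "group_action P (uverts (extended_graph X T)) (extended_action G T \<alpha> \<theta> X \<phi> b)"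
proof (rule group_actionI[OF group_P])
  show "extended_action G T \<alpha> \<theta> X \<phi> b u \<in> extensional (uverts (extended_graph X T))" for u
    by (cases u) (simp add: extended_action_def)
next
  fix u x assume u: "u \<in> carrier P" and x: "x \<in> uverts (extended_graph X T)"
  obtain v i where [simp]: "x = (v, i)" by fastforce
  have "fst u \<in> carrier G" "v \<in> V"
    using u x X by (cases u; simp)+
  then have "\<phi> (fst u) v \<in> V"
    using element_image by blast
  with u x show "extended_action G T \<alpha> \<theta> X \<phi> b u x \<in> uverts (extended_graph X T)"
    by (cases i) (auto simp: extended_action_simps X[symmetric])
next
  fix x assume x: "x \<in> uverts (extended_graph X T)"
  obtain v i where [simp]: "x = (v, i)" by fastforce
  have v: "v \<in> V" using x X by simp
  then have "\<phi> \<one> v = v" by (metis id_eq_one restrict_apply')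
  with x v show "extended_action G T \<alpha> \<theta> X \<phi> b \<one>\<^bsub>P\<^esub> x = x"
    by (cases i) (auto simp: extended_action_simps X[symmetric] sigma_twisted_one, auto simp: P_one)
next
  fix u w x
  assume uw: "u \<in> carrier P" "w \<in> carrier P" and x: "x \<in> uverts (extended_graph X T)"
  obtain g t h s v i where [simp]: "u = (g, t)" "w = (h, s)" "x = (v, i)" by (metis surj_pair)
  have gh: "g \<in> carrier G" "h \<in> carrier G" and v: "v \<in> V" using uw x X by simp_all
  have hv: "\<phi> h v \<in> V" using element_image gh v by blast
  show "extended_action G T \<alpha> \<theta> X \<phi> b (u \<otimes>\<^bsub>P\<^esub> w) x
      = extended_action G T \<alpha> \<theta> X \<phi> b u (extended_action G T \<alpha> \<theta> X \<phi> b w x)"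
  proof (cases i)
    case None
    with gh v hv show ?thesis
      by (simp add: extended_action_simps X[symmetric] composition_rule)
  next
    case (Some \<rho>)
    let ?x = "vertex_coset G \<phi> b v"
    have [simp]: "\<rho> \<in> carrier T" using x Some by simp
    have closed: "sigma_twisted G T \<alpha> \<theta> (g, t) (h <# ?x) \<in> carrier T"
      "sigma_twisted G T \<alpha> \<theta> (h, s) ?x \<in> carrier T"
      using uw gh v by (auto simp del: P_carrier)
    have "extended_action G T \<alpha> \<theta> X \<phi> b (u \<otimes>\<^bsub>P\<^esub> w) x
        = (\<phi> g (\<phi> h v), Some (sigma_twisted G T \<alpha> \<theta> ((g, t) \<otimes>\<^bsub>P\<^esub> (h, s)) ?x \<otimes>\<^bsub>T\<^esub> \<rho>))"
      using gh v Some by (simp add: extended_action_simps X[symmetric] composition_rule)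
    \<comment> \<open>The second map acts at \<open>\<phi> h v\<close>, whose coset is
      \<open>h <# ?x\<close> by equivariance; this is the argument in the first factor of
      \<open>sigma_twisted_mult\<close>.\<close>
    also have "\<dots> = extended_action G T \<alpha> \<theta> X \<phi> b u (extended_action G T \<alpha> \<theta> X \<phi> b w x)"
      using uw gh v hv Some closed
      by (simp add: sigma_twisted_mult extended_action_simps X[symmetric] vertex_coset_equivariant
          T.m_assoc del: P_mult)
    finally show ?thesis .
  qed
qed

text \<open>Each map takes leaves to leaves and the copy of \<open>X\<close> to itself. Edges inside
  the copy are handled by \<open>aut\<close>, and leaf edges by injectivity of
  \<open>\<phi> g\<close>, whatever shift is applied to the leaf indices.\<close>

lemma acts_by_automorphisms_extended:
  assumes X: "V = uverts X"
    and aut: "\<And>g. g \<in> carrier G \<Longrightarrow> graph_automorphism X (\<phi> g)"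
  shows "acts_by_automorphisms P (extended_graph X T) (extended_action G T \<alpha> \<theta> X \<phi> b)"
proof -
  let ?Y = "extended_graph X T"
  interpret E: group_action P "uverts ?Y" "extended_action G T \<alpha> \<theta> X \<phi> b"
    using X by (rule group_action_extended)
  have "graph_automorphism ?Y (extended_action G T \<alpha> \<theta> X \<phi> b u)" if u: "u \<in> carrier P" for u
    unfolding graph_automorphism_def
  proof (intro conjI ballI)
    show "bij_betw (extended_action G T \<alpha> \<theta> X \<phi> b u) (uverts ?Y) (uverts ?Y)"
      using E.bij_prop0[OF u] by (simp add: Bij_def)
  next
    fix x y assume xy: "x \<in> uverts ?Y" "y \<in> uverts ?Y"
    obtain v i w j where [simp]: "x = (v, i)" "y = (w, j)" by (meson surj_pair)
    let ?F = "extended_action G T \<alpha> \<theta> X \<phi> b u"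
    \<comment> \<open>\<open>adjacent_extended\<close> also asks that both ends be vertices, so this
      is needed for the images.\<close>
    have F: "?F x \<in> uverts ?Y" "?F y \<in> uverts ?Y"
      using E.element_image[OF u] xy by blast+
    have g: "fst u \<in> carrier G" using u by (cases u) simp
    have vw: "v \<in> uverts X" "w \<in> uverts X" using xy by simp_all
    have "\<phi> (fst u) v = \<phi> (fst u) w \<longleftrightarrow> v = w"
      using inj_prop[OF g] vw X by (auto dest: inj_onD)
    moreover have "adjacent X (\<phi> (fst u) v) (\<phi> (fst u) w) \<longleftrightarrow> adjacent X v w"
      using aut[OF g] vw by (auto simp: graph_automorphism_def)
    ultimately show "adjacent ?Y x y \<longleftrightarrow> adjacent ?Y (?F x) (?F y)"
      using xy F by (cases i; cases j) (simp_all add: extended_action_simps adjacent_extended)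
  qed
  with E.group_action_axioms show ?thesis by (simp add: acts_by_automorphisms_def)
qed

end


theorem lemma3p1:
  fixes G :: "('g, 'm) monoid_scheme"
    and \<tau> :: "'g topology"
    and X :: "'v ugraph"
    and \<phi> :: "'g \<Rightarrow> 'v \<Rightarrow> 'v"
    and b :: 'v
    and K :: "'g set"
    and T :: "('t, 'n) monoid_scheme"
    and \<alpha> :: "'g \<Rightarrow> 'g \<Rightarrow> 't"
    and \<theta> :: "'g set \<Rightarrow> 'g"
  assumes "locally_compact_group G \<tau>"
    and "tree_graph X" and "locally_finite_graph X" and "infinite (uverts X)"
    and "acts_by_automorphisms G X \<phi>" and "transitive_action G (uverts X) \<phi>"
    and "b \<in> uverts X" and "K = stabilizer G \<phi> b"
    and "maximal_compact_subgroup G \<tau> K"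
    and "comm_group T" and "finite (carrier T)"
    and "normalized_2_cocycle G T \<alpha>"
    and "\<And>k k'. k \<in> K \<Longrightarrow> k' \<in> K \<Longrightarrow> \<alpha> k k' = \<one>\<^bsub>T\<^esub>"
    and "cross_section G K \<theta>"
  shows "tree_graph (extended_graph X T) \<and>
    acts_by_automorphisms (twisted_product G T \<alpha>) (extended_graph X T)
      (extended_action G T \<alpha> \<theta> X \<phi> b)"
proof -
  have grp: "group G" using assms(1) by (simp add: locally_compact_group_def topological_group_on_def)
  interpret group_action G "uverts X" \<phi>
    using assms(5) by (simp add: acts_by_automorphisms_def)
  interpret transitive_extension G T \<alpha> K \<theta> "uverts X" \<phi> b
  proof -
    \<comment> \<open>\<open>K\<close> is a subgroup because it is the stabilizer of
      \<open>b\<close>.\<close>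
    have "subgroup K G"
      using stabilizer_subgroup[OF assms(7)] assms(8) by simp
    then show "transitive_extension G T \<alpha> K \<theta> (uverts X) \<phi> b"
      using grp assms
      by (intro transitive_extension.intro transitive_extension_axioms.intro
          twisted_cross_section.intro twisted_cross_section_axioms.intro
          cocycle_twist.intro cocycle_twist_axioms.intro) auto
  qed
  show ?thesis
  proof
    show "tree_graph (extended_graph X T)"
      using assms(2) by (rule tree_graph_extended)
    show "acts_by_automorphisms P (extended_graph X T) (extended_action G T \<alpha> \<theta> X \<phi> b)"
      using assms(5) by (intro acts_by_automorphisms_extended refl) (simp add: acts_by_automorphisms_def)
  qed
qed

end
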